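(* Let $n$ be an odd positive integer and let $A,B,C,D$ be a Williamson sequence of order $2n$. Write $A=\mathrm{Int}(A_1,A_2')$, $B=\mathrm{Int}(B_1,B_2')$, $C=\mathrm{Int}(C_1,C_2')$, $D=\mathrm{Int}(D_1,D_2')$ with $A_1,A_2,\dots,D_1,D_2$ sequences of length $n$ (i.e., $A_1$ consists of the even-indexed entries of $A$, $A_2'$ of the odd-indexed entries of $A$, and $A_2$ is the unique sequence whose shift is $A_2'$; similarly for $B,C,D$). Then $A_1,A_2,B_1,B_2,C_1,C_2,D_1,D_2$ are 8-Williamson sequences of order $n$.
   Context: A sequence $X=[x_0,\dots,x_{N-1}]$ is symmetric if $x_i=x_{N-i}$ for $1\le i<N$. The periodic autocorrelation function of $X$ is $\mathrm{PAF}_X(s)=\sum_{k=0}^{N-1}x_kx_{(k+s)\bmod N}$. Four symmetric sequences $A,B,C,D\in\{\pm1\}^N$ form a Williamson sequence of order $N$ if $\mathrm{PAF}_A(s)+\mathrm{PAF}_B(s)+\mathrm{PAF}_C(s)+\mathrm{PAF}_D(s)=0$ for $s=1,\dots,\lfloor N/2\rfloor$. Eight symmetric sequences $X_1,\dots,X_8\in\{\pm1\}^n$ are 8-Williamson sequences of order $n$ if $\sum_{i=1}^8\mathrm{PAF}_{X_i}(s)=0$ for $s=1,\dots,n-1$. For $n$ odd and $X=[x_0,\dots,x_{n-1}]$, the shift $X'$ is $[x_{(n-1)/2},\dots,x_{n-1},x_0,\dots,x_{(n-3)/2}]$, i.e., $X'_k=x_{(k+(n-1)/2)\bmod n}$;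 for $X,Y$ of length $n$, $\mathrm{Int}(X,Y)=[x_0,y_0,x_1,y_1,\dots,x_{n-1},y_{n-1}]$.
   Formalization: The shift X' is taken as X'_k = x_{(k+(n+1)/2) mod n} instead of x_{(k+(n-1)/2) mod n}; with the latter the claim fails, e.g. for n=3 and A=[1,1,1,-1,1,1], where A_2=[1,1,-1] is not symmetric. *)

theory Defs
  imports Main
begin

definition symmetric_seq :: "int list \<Rightarrow> bool" where
  "symmetric_seq X \<longleftrightarrow>
     (\<forall>i. 1 \<le> i \<and> i < length X \<longrightarrow> X ! i = X ! (length X - i))"

definition PAF :: "int list \<Rightarrow> nat \<Rightarrow> int" where
  "PAF X s = (\<Sum>k<length X. X ! k * X ! ((k + s) mod length X))"

definition sym_pm1_seq :: "nat \<Rightarrow> int list \<Rightarrow> bool" where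
  "sym_pm1_seq N X \<longleftrightarrow> length X = N \<and> set X \<subseteq> {-1, 1} \<and> symmetric_seq X"

definition williamson ::
    "nat \<Rightarrow> int list \<Rightarrow> int list \<Rightarrow> int list \<Rightarrow> int list \<Rightarrow> bool" where
  "williamson N A B C D \<longleftrightarrow>
     (\<forall>X\<in>{A, B, C, D}. sym_pm1_seq N X) \<and>
     (\<forall>s\<in>{1..N div 2}. PAF A s + PAF B s + PAF C s + PAF D s = 0)"

text \<open>The eight sequences are collected in a list, since repetitions among them are allowed.\<close>

definition eight_williamson :: "nat \<Rightarrow> int list list \<Rightarrow> bool" where
  "eight_williamson n Xs \<longleftrightarrow>
     length Xs = 8 \<and>
     (\<forall>X\<in>set Xs. sym_pm1_seq n X) \<and>
     (\<forall>s\<in>{1..n - 1}. (\<Sum>X\<leftarrow>Xs. PAF X s) = 0)"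

text \<open>
  For odd \<open>n = length X\<close> the result has \<open>k\<close>-th entry \<open>X ! ((k + (n + 1) div 2) mod n)\<close>: it is
  the cyclic shift by \<open>(n - 1) div 2\<close> places to the right. Correction: the shift is also found
  in print with \<open>(n - 1) div 2\<close> in place of \<open>(n + 1) div 2\<close>, which is off by one. The odd-indexed
  entries of a symmetric sequence of length \<open>2 * n\<close> form a palindrome, and it is the rotation used
  here that turns symmetric sequences into palindromes. With the other one the decomposition of
  Williamson sequences of order \<open>2 * n\<close> into 8-Williamson sequences already fails for \<open>n = 3\<close> and
  \<open>[1,1,1,-1,1,1]\<close>, \<open>[1,1,-1,1,-1,1]\<close>, \<open>[1,1,-1,-1,-1,1]\<close>, \<open>[1,-1,-1,1,-1,-1]\<close>: the odd-indexed
  entries \<open>[1,-1,1]\<close> of the first would come from \<open>[1,1,-1]\<close>, which is not symmetric.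
\<close>

definition half_shift :: "int list \<Rightarrow> int list" where
  "half_shift X = rotate ((length X + 1) div 2) X"

text \<open>On lists of equal length, \<open>splice\<close> is the interleaving \<open>[x\<^sub>0, y\<^sub>0, x\<^sub>1, y\<^sub>1, \<dots>]\<close>.\<close>

abbreviation Interleave :: "int list \<Rightarrow> int list \<Rightarrow> int list" where
  "Interleave X Y \<equiv> splice X Y"

end

(* Even shifts of an interleaving never mix the even- and odd-indexed entries, so its
   autocorrelation at 2 * s is the sum of those of the two halves at s, and rotating a half does
   not change its autocorrelation. This settles s \<le> n div 2; the identity PAF X (n - s) = PAF X s
   settles the other s. *)

theory Submission
  imports Defs
begin

lemma set_splice: "set (splice xs ys) = set xs \<union> set ys"
  by (induction xs ys rule: splice.induct) auto

lemma nth_splice: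
  assumes "length xs = length ys" "k < length xs"
  shows nth_splice_even: "splice xs ys ! (2 * k) = xs ! k"
    and nth_splice_odd: "splice xs ys ! (2 * k + 1) = ys ! k"
proof -
  have "splice xs ys ! (2 * k) = xs ! k \<and> splice xs ys ! (2 * k + 1) = ys ! k"
    using assms
  proof (induction xs ys arbitrary: k rule: list_induct2)
    case (Cons x xs y ys)
    then show ?case by (cases k) auto
  qed simp
  then show "splice xs ys ! (2 * k) = xs ! k" "splice xs ys ! (2 * k + 1) = ys ! k"
    by auto
qed

lemma sum_lessThan_double:
  fixes f :: "nat \<Rightarrow> 'a::comm_monoid_add"
  shows "sum f {..<2 * n} = (\<Sum>k<n. f (2 * k)) + (\<Sum>k<n. f (2 * k + 1))"
  by (induction n) (auto simp: ac_simps)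

text \<open>Adding \<open>r\<close> permutes the residues modulo \<open>n\<close>. The induction on
  \<open>r\<close> needs only the shift by one, which moves the first summand to the end; for
  \<open>n = 0\<close> both sums are empty.\<close>

lemma sum_cyclic_shift:
  fixes f :: "nat \<Rightarrow> 'a::comm_monoid_add"
  shows "(\<Sum>k<n. f ((k + r) mod n)) = (\<Sum>k<n. f k)"
proof (induction r)
  case (Suc r)
  show ?case
  proof (cases n)
    case (Suc m)
    let ?g = "\<lambda>k. f ((k + r) mod n)"
    have "(\<Sum>k<n. f ((k + Suc r) mod n)) = (\<Sum>k<Suc m. ?g (Suc k))"
      using Suc by simp
    also have "\<dots> = (\<Sum>k<m. ?g (Suc k)) + ?g n"
      using Suc by simp
    also have "\<dots> = (\<Sum>k<m. ?g (Suc k)) + ?g 0"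
      by simp
    also have "\<dots> = (\<Sum>k<Suc m. ?g k)"
      by (simp add: sum.lessThan_Suc_shift add.commute del: sum.lessThan_Suc)
    finally show ?thesis
      using Suc.IH Suc by simp
  qed simp
qed simp

text \<open>Rotation is the substitution of \<open>k + r\<close> for \<open>k\<close>; it moves both
  factors of each product alike, so the summands are merely permuted cyclically.\<close>

lemma PAF_rotate: "PAF (rotate r X) s = PAF X s"
proof -
  let ?n = "length X"
  let ?f = "\<lambda>k. X ! k * X ! ((k + s) mod ?n)"
  have "PAF (rotate r X) s = (\<Sum>k<?n. ?f ((k + r) mod ?n))"
    unfolding PAF_def length_rotate
  proof (rule sum.cong)
    fix k assume "k \<in> {..<?n}"
    then have "k < ?n" "(k + s) mod ?n < ?n"
      by (auto intro: mod_less_divisor)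
    moreover have "(r + (k + s) mod ?n) mod ?n = ((k + r) mod ?n + s) mod ?n"
      by (simp add: mod_simps add.commute add.left_commute)
    ultimately show "rotate r X ! k * rotate r X ! ((k + s) mod ?n) = ?f ((k + r) mod ?n)"
      by (simp add: nth_rotate add.commute[of k r])
  qed simp
  then show ?thesis
    by (simp add: sum_cyclic_shift[of ?f] PAF_def)
qed

text \<open>A shift by \<open>length X - s\<close> is a shift back by \<open>s\<close>. Replacing
  \<open>k\<close> by \<open>k + s\<close> makes the second factor \<open>X ! k\<close>, so the same
  pairs are multiplied with their factors exchanged.\<close>

lemma PAF_complement:
  assumes "s \<le> length X"
  shows "PAF X (length X - s) = PAF X s"
proof -
  let ?n = "length X"
  let ?f = "\<lambda>k. X ! k * X ! ((k + (?n - s)) mod ?n)"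
  have "PAF X (?n - s) = (\<Sum>k<?n. ?f ((k + s) mod ?n))"
    by (simp add: PAF_def sum_cyclic_shift[of ?f])
  also have "\<dots> = PAF X s"
    unfolding PAF_def
  proof (rule sum.cong)
    fix k assume "k \<in> {..<?n}"
    moreover have "((k + s) mod ?n + (?n - s)) mod ?n = (k + s + (?n - s)) mod ?n"
      by (rule mod_add_left_eq)
    ultimately have "((k + s) mod ?n + (?n - s)) mod ?n = k"
      using assms by simp
    then show "?f ((k + s) mod ?n) = X ! k * X ! ((k + s) mod ?n)"
      by simp
  qed simp
  finally show ?thesis .
qed

lemma PAF_splice_even:
  assumes "length X = length Y"
  shows "PAF (splice X Y) (2 * s) = PAF X s + PAF Y s"
proof -
  let ?n = "length Y" and ?Z = "splice X Y"
  have len: "length ?Z = 2 * ?n"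
    using assms by simp
  \<comment> \<open>The modulus \<open>2 * ?n\<close> is even, so reduction preserves parity; on the
    index halved and rounded down it acts as reduction modulo \<open>?n\<close>.\<close>
  have ev: "(2 * k + 2 * s) mod (2 * ?n) = 2 * ((k + s) mod ?n)" for k
    using mod_mult2_eq[of "2 * (k + s)" 2 ?n] by simp
  have od: "(2 * k + 1 + 2 * s) mod (2 * ?n) = 2 * ((k + s) mod ?n) + 1" for k
  proof -
    have "2 * k + 1 + 2 * s = 2 * (k + s) + 1" by simp
    then show ?thesis
      using mod_mult2_eq[of "2 * (k + s) + 1" 2 ?n] by simp
  qed
  have "PAF ?Z (2 * s) = (\<Sum>k<?n. ?Z ! (2 * k) * ?Z ! ((2 * k + 2 * s) mod (2 * ?n)))
      + (\<Sum>k<?n. ?Z ! (2 * k + 1) * ?Z ! ((2 * k + 1 + 2 * s) mod (2 * ?n)))"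
    unfolding PAF_def len by (rule sum_lessThan_double)
  also have "(\<Sum>k<?n. ?Z ! (2 * k) * ?Z ! ((2 * k + 2 * s) mod (2 * ?n))) = PAF X s"
    unfolding PAF_def assms
  proof (rule sum.cong)
    fix k assume "k \<in> {..<?n}"
    then have "k < ?n" "(k + s) mod ?n < ?n"
      by (auto intro: mod_less_divisor)
    then show "?Z ! (2 * k) * ?Z ! ((2 * k + 2 * s) mod (2 * ?n)) = X ! k * X ! ((k + s) mod ?n)"
      unfolding ev by (simp add: nth_splice_even assms)
  qed simp
  also have "(\<Sum>k<?n. ?Z ! (2 * k + 1) * ?Z ! ((2 * k + 1 + 2 * s) mod (2 * ?n))) = PAF Y s"
    unfolding PAF_def
  proof (rule sum.cong)
    fix k assume "k \<in> {..<?n}"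
    then have k: "k < ?n" "(k + s) mod ?n < ?n"
      by (auto intro: mod_less_divisor)
    show "?Z ! (2 * k + 1) * ?Z ! ((2 * k + 1 + 2 * s) mod (2 * ?n)) = Y ! k * Y ! ((k + s) mod ?n)"
      unfolding od using k by (simp only: nth_splice_odd assms)
  qed simp
  finally show ?thesis .
qed

lemma PAF_Interleave_half_shift:
  assumes "length X = length Y"
  shows "PAF (Interleave X (half_shift Y)) (2 * s) = PAF X s + PAF Y s"
  using assms by (simp add: PAF_splice_even PAF_rotate half_shift_def)

text \<open>The reflection of \<open>j\<close> to \<open>2 * n - j\<close> preserves parity, and on
  even indices \<open>j = 2 * i\<close> it is the reflection of \<open>i\<close> to
  \<open>n - i\<close>.\<close>

lemma symmetric_seq_splice_left:
  assumes "length X = length Y" "symmetric_seq (splice X Y)"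
  shows "symmetric_seq X"
  unfolding symmetric_seq_def
proof (intro allI impI)
  let ?n = "length X"
  fix i assume i: "1 \<le> i \<and> i < ?n"
  have "length (splice X Y) = 2 * ?n"
    using assms(1) by simp
  then have "splice X Y ! (2 * i) = splice X Y ! (2 * ?n - 2 * i)"
    using assms(2) i by (simp add: symmetric_seq_def del: length_splice)
  moreover have "2 * ?n - 2 * i = 2 * (?n - i)" by simp
  moreover have "i < ?n" "?n - i < ?n"
    using i by auto
  ultimately show "X ! i = X ! (?n - i)"
    using nth_splice_even[OF assms(1), of i] nth_splice_even[OF assms(1), of "?n - i"] by simp
qed

text \<open>On odd indices \<open>j = 2 * k + 1\<close> the same reflection sends \<open>k\<close>
  to \<open>n - 1 - k\<close>. It therefore pairs position 0 with the last one, unlike the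
  reflection in \<open>symmetric_seq\<close>, which leaves position 0 alone.\<close>

lemma palindrome_splice_right:
  assumes "length X = length Y" "symmetric_seq (splice X Y)" "k < length Y"
  shows "Y ! k = Y ! (length Y - 1 - k)"
proof -
  let ?n = "length Y"
  have "length (splice X Y) = 2 * ?n"
    using assms(1) by simp
  then have "splice X Y ! (2 * k + 1) = splice X Y ! (2 * ?n - (2 * k + 1))"
    using assms(2,3) by (simp add: symmetric_seq_def del: length_splice)
  moreover have "2 * ?n - (2 * k + 1) = 2 * (?n - 1 - k) + 1"
    using assms(3) by simp
  ultimately show ?thesis
    using assms nth_splice_odd[of X Y k] nth_splice_odd[of X Y "?n - 1 - k"] by simp
qed

text \<open>A palindrome of odd length \<open>2 * m + 1\<close> has a centre, at \<open>m\<close>.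
  The half shift takes its entry there from position 0 of \<open>Y\<close>, so reflection about the
  centre becomes reflection about 0 modulo the length.\<close>

lemma symmetric_seq_of_half_shift_palindrome:
  assumes "odd (length Y)"
    and pal: "\<And>k. k < length Y \<Longrightarrow> half_shift Y ! k = half_shift Y ! (length Y - 1 - k)"
  shows "symmetric_seq Y"
proof -
  obtain m where m: "length Y = 2 * m + 1"
    using assms(1) by (auto elim: oddE)
  have nth: "half_shift Y ! k = Y ! ((m + 1 + k) mod (2 * m + 1))" if "k < 2 * m + 1" for k
  proof -
    have "(length Y + 1) div 2 = m + 1" using m by simp
    then show ?thesis
      unfolding half_shift_def using that m by (simp only: nth_rotate)
  qed
  have low: "Y ! i = Y ! (length Y - i)" if "1 \<le> i" "i \<le> m" for i
  proof -
    have "half_shift Y ! (m + i) = half_shift Y ! (m - i)"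
      using pal[of "m + i"] that m by simp
    \<comment> \<open>The position for \<open>m + i\<close> wraps around exactly once and gives
      \<open>i\<close>; the one for \<open>m - i\<close> stays below the length because
      \<open>1 \<le> i\<close>.\<close>
    moreover have "m + 1 + (m + i) = i + (2 * m + 1)" "m + 1 + (m - i) = length Y - i"
      using that m by auto
    then have "(m + 1 + (m + i)) mod (2 * m + 1) = i"
      "(m + 1 + (m - i)) mod (2 * m + 1) = length Y - i"
      using that m by (simp_all only: mod_add_self2) auto
    ultimately show ?thesis
      using that nth[of "m + i"] nth[of "m - i"] by simp
  qed
  show ?thesis
    unfolding symmetric_seq_def
  proof (intro allI impI)
    fix i assume i: "1 \<le> i \<and> i < length Y"
    show "Y ! i = Y ! (length Y - i)"
    \<comment> \<open>The claim is unchanged when \<open>i\<close> and \<open>length Y - i\<close>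
      are swapped, and one of the two is at most \<open>m\<close>.\<close>
    proof (cases "i \<le> m")
      case False
      then show ?thesis
        using i m low[of "length Y - i"] by simp
    qed (use i low in auto)
  qed
qed

text \<open>Interleaving and rotation only rearrange entries, so all of them stay \<plusminus>1; the
  symmetry of \<open>Y\<close> is recovered through the palindrome formed by the odd-indexed
  entries.\<close>

lemma sym_pm1_seq_Interleave_half_shift:
  assumes "odd n" "length X = n" "length Y = n"
    and "sym_pm1_seq (2 * n) (Interleave X (half_shift Y))"
  shows "sym_pm1_seq n X" "sym_pm1_seq n Y"
proof -
  have len: "length X = length (half_shift Y)" "length (half_shift Y) = n"
    using assms by (simp_all add: half_shift_def)
  have sym: "symmetric_seq (splice X (half_shift Y))"
    and ran: "set X \<subseteq> {-1, 1}" "set Y \<subseteq> {-1, 1}"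
    using assms(4) by (auto simp: sym_pm1_seq_def set_splice half_shift_def)
  show "sym_pm1_seq n X"
    using symmetric_seq_splice_left[OF len(1) sym] ran assms by (simp add: sym_pm1_seq_def)
  have "symmetric_seq Y"
  proof (rule symmetric_seq_of_half_shift_palindrome)
    show "odd (length Y)" using assms by simp
    show "half_shift Y ! k = half_shift Y ! (length Y - 1 - k)" if "k < length Y" for k
      using palindrome_splice_right[OF len(1) sym, of k] that unfolding len(2) assms(3) .
  qed
  then show "sym_pm1_seq n Y"
    using ran assms by (simp add: sym_pm1_seq_def)
qed

theorem theorem7:
  fixes n :: nat and A B C D A1 A2 B1 B2 C1 C2 D1 D2 :: "int list"
  assumes "odd n"
    and "williamson (2 * n) A B C D"
    and "\<forall>X\<in>{A1, A2, B1, B2, C1, C2, D1, D2}. length X = n"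
    and "A = Interleave A1 (half_shift A2)"
    and "B = Interleave B1 (half_shift B2)"
    and "C = Interleave C1 (half_shift C2)"
    and "D = Interleave D1 (half_shift D2)"
  shows "eight_williamson n [A1, A2, B1, B2, C1, C2, D1, D2]"
proof -
  let ?Xs = "[A1, A2, B1, B2, C1, C2, D1, D2]"
  have sym: "\<forall>X\<in>set ?Xs. sym_pm1_seq n X"
  proof -
    have "sym_pm1_seq n X \<and> sym_pm1_seq n Y"
      if "(X, Y) \<in> {(A1, A2), (B1, B2), (C1, C2), (D1, D2)}" for X Y
    proof -
      have "length X = n" "length Y = n" "sym_pm1_seq (2 * n) (Interleave X (half_shift Y))"
        using that assms(2-7) by (auto simp: williamson_def)
      then show ?thesis
        using sym_pm1_seq_Interleave_half_shift[OF \<open>odd n\<close>] by blast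
    qed
    from this[of A1 A2] this[of B1 B2] this[of C1 C2] this[of D1 D2]
    show ?thesis by simp
  qed
  have low: "(\<Sum>X\<leftarrow>?Xs. PAF X s) = 0" if "1 \<le> s" "2 * s \<le> n" for s
  proof -
    \<comment> \<open>Order \<open>2 * n\<close> provides the vanishing sums at shifts up to
      \<open>n\<close>, hence at \<open>2 * s\<close> exactly when
      \<open>2 * s \<le> n\<close>.\<close>
    have "PAF A (2 * s) + PAF B (2 * s) + PAF C (2 * s) + PAF D (2 * s) = 0"
      using assms(2) that by (simp add: williamson_def)
    then show ?thesis
      using assms(3-7) by (simp add: PAF_Interleave_half_shift)
  qed
  have "(\<Sum>X\<leftarrow>?Xs. PAF X s) = 0" if s: "1 \<le> s" "s \<le> n - 1" for s
  proof (cases "2 * s \<le> n")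
    case False
    \<comment> \<open>From \<open>n < 2 * s\<close> and \<open>s \<le> n - 1\<close> it follows that
      \<open>n - s\<close> lies in the range of \<open>low\<close>.\<close>
    have "PAF X (n - s) = PAF X s" if "X \<in> set ?Xs" for X
      using PAF_complement[of s X] assms(3) s that by auto
    then have "(\<Sum>X\<leftarrow>?Xs. PAF X s) = (\<Sum>X\<leftarrow>?Xs. PAF X (n - s))"
      by simp
    then show ?thesis
      using low[of "n - s"] False s by simp
  qed (use low s in blast)
  with sym show ?thesis
    by (simp add: eight_williamson_def)
qed

end
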